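(* Let $\mathbb{F}$ be a field and let $$\mathcal{E}:\quad D\xrightarrow{\,i\,}D\xrightarrow{\,j\,}E\xrightarrow{\,k\,}D$$ be an exact couple of order $a\in\mathbb{Z}$ of bigraded $\mathbb{F}$-vector spaces, with $E$ of finite total dimension. Let $B^{(r)}, Z^{(r)}\subseteq E$ and $\overline d^{(r)}:Z^{(r)}/Z^{(r+1)}\to B^{(r+1)}/B^{(r)}$ be as in the context, and let $N$ be such that $B^{(r)}=B^{(r+1)}$ and $Z^{(r)}=Z^{(r+1)}$ for all $r\ge N$. Define, for $\ell\in\mathbb{Z}$, $$C_\ell:=\bigoplus_{p+q=\ell}\Big((B^{(1)}_{p,q}/B^{(0)}_{p,q})\oplus\cdots\oplus(B^{(N)}_{p,q}/B^{(N-1)}_{p,q})\oplus(Z^{(N)}_{p,q}/B^{(N)}_{p,q})\oplus(Z^{(N-1)}_{p,q}/Z^{(N)}_{p,q})\oplus\cdots\oplus(Z^{(0)}_{p,q}/Z^{(1)}_{p,q})\Big)$$ and $$\partial_\ell:=\bigoplus_{p+q=\ell}\ \bigoplus_{r=0}^{N-1}\overline d^{(r)}_{p,q},$$ i.e. $\partial_\ell$ maps each summand $Z^{(r)}_{p,q}/Z^{(r+1)}_{p,q}$ ($0\le r\le N-1$) by $\overline d^{(r)}_{p,q}$ into the corresponding summand of $B^{(r+1)}/B^{(r)}$ in $C_{\ell-1}$, and is zero on all other summands. Then $(C_\bullet,\partial_\bullet)$ is a chain complex, i.e. $\partial_{\ell-1}\circ\partial_\ell=0$ for all $\ell$.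
   Context: An exact couple of order $a$ consists of bigraded vector spaces $D=\bigoplus_{p,q\in\mathbb{Z}}D_{p,q}$, $E=\bigoplus_{p,q\in\mathbb{Z}}E_{p,q}$ and bigraded linear maps $i:D\to D$, $j:D\to E$, $k:E\to D$ of bidegrees $(1,-1)$, $(-a,a)$, $(-1,0)$ with $\ker i=\operatorname{im}k$, $\ker j=\operatorname{im}i$, $\ker k=\operatorname{im}j$. A bigraded space is of finite total dimension if all its components are finite dimensional and only finitely many are nonzero. For $r\ge0$ (with $i^0=\mathrm{id}_D$), $B^{(r)}:=j(\ker(i^r))$ and $Z^{(r)}:=k^{-1}(\operatorname{im}(i^r))$; these are bigraded subspaces of $E$ with $0=B^{(0)}\subseteq B^{(1)}\subseteq\cdots\subseteq Z^{(1)}\subseteq Z^{(0)}=E$. The pages of the spectral sequence of $\mathcal{E}$ are $E^{(r)}:=Z^{(r)}/B^{(r)}$, with differential $d^{(r)}([\alpha])=[j(x)]$ where $k(\alpha)=i^r(x)$; its bidegree is $(-(a+r)-1,\,a+r)$. The map $\overline d^{(r)}:Z^{(r)}/Z^{(r+1)}\to B^{(r+1)}/B^{(r)}$ is the map induced by $d^{(r)}$, i.e. $\overline d^{(r)}([\alpha])=[j(x)]$ for any $x\in D$ with $k(\alpha)=i^r(x)$; $\overline d^{(r)}_{p,q}$ is its restriction to the component of bidegree $(p,q)$. *)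

theory Defs
  imports "HOL-Algebra.AbelCoset" "Jordan_Normal_Form.Missing_VectorSpace"
begin

section \<open>Bigraded vector spaces\<close>

text \<open>A bigraded space is an internal direct sum: a vector space \<open>V\<close> together with subspaces
  \<open>G (p, q)\<close> such that every vector is, in exactly one way, a finite sum of homogeneous components.\<close>

definition bigraded_space ::
  "('f, 'k) ring_scheme \<Rightarrow> ('f, 'v, 'm) module_scheme \<Rightarrow> (int \<times> int \<Rightarrow> 'v set) \<Rightarrow> bool" where
  "bigraded_space K V G \<longleftrightarrow>
     vectorspace K V \<and> (\<forall>b. subspace K (G b) V) \<and>
     (\<forall>v\<in>carrier V. \<exists>!c. (\<forall>b. c b \<in> G b) \<and> finite {b. c b \<noteq> \<zero>\<^bsub>V\<^esub>} \<and>
        v = (\<Oplus>\<^bsub>V\<^esub>b\<in>{b. c b \<noteq> \<zero>\<^bsub>V\<^esub>}. c b))"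

definition finite_total_dim ::
  "('f, 'k) ring_scheme \<Rightarrow> ('f, 'v, 'm) module_scheme \<Rightarrow> (int \<times> int \<Rightarrow> 'v set) \<Rightarrow> bool" where
  "finite_total_dim K V G \<longleftrightarrow>
     (\<forall>b. vectorspace.fin_dim K (V\<lparr>carrier := G b\<rparr>)) \<and> finite {b. G b \<noteq> {\<zero>\<^bsub>V\<^esub>}}"

definition bigraded_linear_map ::
  "('f, 'k) ring_scheme \<Rightarrow> ('f, 'v, 'm) module_scheme \<Rightarrow> (int \<times> int \<Rightarrow> 'v set) \<Rightarrow>
   ('f, 'w, 'n) module_scheme \<Rightarrow> (int \<times> int \<Rightarrow> 'w set) \<Rightarrow> int \<times> int \<Rightarrow> ('v \<Rightarrow> 'w) \<Rightarrow> bool" where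
  "bigraded_linear_map K V G W H s f \<longleftrightarrow>
     linear_map K V W f \<and> (\<forall>p q. f ` G (p, q) \<subseteq> H (p + fst s, q + snd s))"


section \<open>Exact couples\<close>

record ('f, 'd, 'e) couple =
  spD :: "('f, 'd) module"
  grD :: "int \<times> int \<Rightarrow> 'd set"
  spE :: "('f, 'e) module"
  grE :: "int \<times> int \<Rightarrow> 'e set"
  map_i :: "'d \<Rightarrow> 'd"
  map_j :: "'d \<Rightarrow> 'e"
  map_k :: "'e \<Rightarrow> 'd"

definition exact_couple ::
  "('f, 'k) ring_scheme \<Rightarrow> int \<Rightarrow> ('f, 'd, 'e) couple \<Rightarrow> bool" where
  "exact_couple K a X \<longleftrightarrow>
     bigraded_space K (spD X) (grD X) \<and>
     bigraded_space K (spE X) (grE X) \<and>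
     bigraded_linear_map K (spD X) (grD X) (spD X) (grD X) (1, -1) (map_i X) \<and>
     bigraded_linear_map K (spD X) (grD X) (spE X) (grE X) (-a, a) (map_j X) \<and>
     bigraded_linear_map K (spE X) (grE X) (spD X) (grD X) (-1, 0) (map_k X) \<and>
     mod_hom.ker (spD X) (spD X) (map_i X) = map_k X ` carrier (spE X) \<and>
     mod_hom.ker (spD X) (spE X) (map_j X) = map_i X ` carrier (spD X) \<and>
     mod_hom.ker (spE X) (spD X) (map_k X) = map_j X ` carrier (spD X)"

definition B_space :: "('f, 'd, 'e) couple \<Rightarrow> nat \<Rightarrow> 'e set" where
  "B_space X r = map_j X ` mod_hom.ker (spD X) (spD X) (map_i X ^^ r)"

definition Z_space :: "('f, 'd, 'e) couple \<Rightarrow> nat \<Rightarrow> 'e set" where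
  "Z_space X r = {\<alpha> \<in> carrier (spE X). map_k X \<alpha> \<in> (map_i X ^^ r) ` carrier (spD X)}"

definition B_comp :: "('f, 'd, 'e) couple \<Rightarrow> nat \<Rightarrow> int \<times> int \<Rightarrow> 'e set" where
  "B_comp X r b = B_space X r \<inter> grE X b"

definition Z_comp :: "('f, 'd, 'e) couple \<Rightarrow> nat \<Rightarrow> int \<times> int \<Rightarrow> 'e set" where
  "Z_comp X r b = Z_space X r \<inter> grE X b"


section \<open>Quotients and direct sums of vector spaces\<close>

text \<open>The record type of modules extends that of rings; as in \<^const>\<open>direct_sum\<close>, the fields
  \<open>mult\<close> and \<open>one\<close> below carry no meaning.\<close>

definition quotient_space :: "('f, 'v, 'm) module_scheme \<Rightarrow> 'v set \<Rightarrow> ('f, 'v set) module" where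
  "quotient_space V W =
     \<lparr>carrier = a_rcosets\<^bsub>V\<^esub> W,
      mult = (\<lambda>A B. W),
      one = W,
      zero = W,
      add = (\<lambda>A B. A <+>\<^bsub>V\<^esub> B),
      smult = (\<lambda>c A. \<Union>v\<in>A. W +>\<^bsub>V\<^esub> (c \<odot>\<^bsub>V\<^esub> v))\<rparr>"

definition direct_sum_family ::
  "'i set \<Rightarrow> ('i \<Rightarrow> ('f, 'v, 'm) module_scheme) \<Rightarrow> ('f, 'i \<Rightarrow> 'v) module" where
  "direct_sum_family I V =
     \<lparr>carrier = {x \<in> (\<Pi>\<^sub>E i\<in>I. carrier (V i)). finite {i \<in> I. x i \<noteq> \<zero>\<^bsub>V i\<^esub>}},
      mult = (\<lambda>x y. \<lambda>i\<in>I. \<zero>\<^bsub>V i\<^esub>),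
      one = (\<lambda>i\<in>I. \<zero>\<^bsub>V i\<^esub>),
      zero = (\<lambda>i\<in>I. \<zero>\<^bsub>V i\<^esub>),
      add = (\<lambda>x y. \<lambda>i\<in>I. x i \<oplus>\<^bsub>V i\<^esub> y i),
      smult = (\<lambda>c x. \<lambda>i\<in>I. c \<odot>\<^bsub>V i\<^esub> x i)\<rparr>"


section \<open>The differentials\<close>

text \<open>The induced map from \<open>Z\<^sup>r / Z\<^sup>r\<^sup>+\<^sup>1\<close> to \<open>B\<^sup>r\<^sup>+\<^sup>1 / B\<^sup>r\<close>, on cosets. The description
  determines the value because it depends neither on the representative \<open>\<alpha>\<close> nor on \<open>x\<close>.\<close>

definition dbar :: "('f, 'd, 'e) couple \<Rightarrow> nat \<Rightarrow> 'e set \<Rightarrow> 'e set" where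
  "dbar X r A = (THE Y. \<exists>\<alpha>\<in>A. \<exists>x\<in>carrier (spD X).
     map_k X \<alpha> = (map_i X ^^ r) x \<and> Y = B_space X r +>\<^bsub>spE X\<^esub> map_j X x)"

text \<open>Its restriction to the component of bidegree \<open>b\<close>. A coset \<open>\<alpha> + Z_comp X (r + 1) b\<close> is identified
  with the coset \<open>\<alpha> + Z_space X (r + 1)\<close>; conversely, a coset of \<open>B_space X r\<close> that has a
  representative of bidegree \<open>b'\<close> is identified with the coset of \<open>B_comp X r b'\<close> formed by all its
  elements of bidegree \<open>b'\<close>.\<close>

definition dbar_comp ::
  "int \<Rightarrow> ('f, 'd, 'e) couple \<Rightarrow> nat \<Rightarrow> int \<times> int \<Rightarrow> 'e set \<Rightarrow> 'e set" where
  "dbar_comp a X r b A =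
     dbar X r (Z_space X (r + 1) <+>\<^bsub>spE X\<^esub> A) \<inter>
     grE X (fst b - (a + int r) - 1, snd b + (a + int r))"


section \<open>The total complex\<close>

text \<open>\<open>Bquot r\<close>, \<open>Middle\<close> and \<open>Zquot r\<close> index the summands \<open>B\<^sup>r\<^sup>+\<^sup>1 / B\<^sup>r\<close>, \<open>Z\<^sup>N / B\<^sup>N\<close> and
  \<open>Z\<^sup>r / Z\<^sup>r\<^sup>+\<^sup>1\<close>, where \<open>r < N\<close>.\<close>

datatype slot = Bquot nat | Middle | Zquot nat

definition slots :: "nat \<Rightarrow> slot set" where
  "slots N = Bquot ` {..<N} \<union> {Middle} \<union> Zquot ` {..<N}"

fun slot_space ::
  "('f, 'd, 'e) couple \<Rightarrow> nat \<Rightarrow> int \<times> int \<Rightarrow> slot \<Rightarrow> ('f, 'e set) module" where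
  "slot_space X N b (Bquot r) =
     quotient_space ((spE X)\<lparr>carrier := B_comp X (r + 1) b\<rparr>) (B_comp X r b)"
| "slot_space X N b Middle =
     quotient_space ((spE X)\<lparr>carrier := Z_comp X N b\<rparr>) (B_comp X N b)"
| "slot_space X N b (Zquot r) =
     quotient_space ((spE X)\<lparr>carrier := Z_comp X r b\<rparr>) (Z_comp X (r + 1) b)"

definition total_space ::
  "('f, 'd, 'e) couple \<Rightarrow> nat \<Rightarrow> int \<Rightarrow> ('f, int \<times> int \<Rightarrow> slot \<Rightarrow> 'e set) module" where
  "total_space X N l =
     direct_sum_family {(p, q). p + q = l} (\<lambda>b. direct_sum_family (slots N) (slot_space X N b))"

text \<open>The direct sum of the maps \<open>dbar_comp\<close>, written by its coordinates in the target: the only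
  summand of degree \<open>l\<close> that reaches \<open>Bquot r\<close> in bidegree \<open>(p, q)\<close> is \<open>Zquot r\<close> in the bidegree
  \<open>(p + (a + r) + 1, q - (a + r))\<close>.\<close>

definition total_diff ::
  "int \<Rightarrow> ('f, 'd, 'e) couple \<Rightarrow> nat \<Rightarrow> int \<Rightarrow>
   (int \<times> int \<Rightarrow> slot \<Rightarrow> 'e set) \<Rightarrow> int \<times> int \<Rightarrow> slot \<Rightarrow> 'e set" where
  "total_diff a X N l x =
     (\<lambda>(p, q)\<in>{(p, q). p + q = l - 1}. \<lambda>s\<in>slots N.
        case s of
          Bquot r \<Rightarrow>
            (let b = (p + (a + int r) + 1, q - (a + int r))
             in dbar_comp a X r b (x b (Zquot r)))
        | _ \<Rightarrow> \<zero>\<^bsub>slot_space X N (p, q) s\<^esub>)"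

definition chain_complex ::
  "('f, 'k) ring_scheme \<Rightarrow> (int \<Rightarrow> ('f, 'c, 'm) module_scheme) \<Rightarrow> (int \<Rightarrow> 'c \<Rightarrow> 'c) \<Rightarrow> bool" where
  "chain_complex K C d \<longleftrightarrow>
     (\<forall>l. linear_map K (C l) (C (l - 1)) (d l)) \<and>
     (\<forall>l. \<forall>x\<in>carrier (C l). d (l - 1) (d l x) = \<zero>\<^bsub>C (l - 1 - 1)\<^esub>)"

end

theory Submission
  imports Defs
begin

text \<open>That \<open>\<partial> \<circ> \<partial> = 0\<close> is immediate, since \<open>\<partial>\<close> starts from the summands \<open>Z\<^sup>r / Z\<^sup>r\<^sup>+\<^sup>1\<close> and ends in
  the summands \<open>B\<^sup>r\<^sup>+\<^sup>1 / B\<^sup>r\<close>. The content is that \<open>\<partial>\<close> is a well-defined linear map. A homogeneous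
  \<open>\<alpha>\<close> in \<open>Z\<^sup>r\<close> satisfies \<open>k \<alpha> = i\<^sup>r x\<close> with \<open>x\<close> homogeneous, because homogeneous components are
  unique; then the class of \<open>\<alpha>\<close> goes to the class of the homogeneous element \<open>j x\<close>, which lies in
  \<open>B\<^sup>r\<^sup>+\<^sup>1\<close> because \<open>i\<^sup>r\<^sup>+\<^sup>1 x = i (k \<alpha>) = 0\<close>. This formula is linear in the pair \<open>(\<alpha>, x)\<close>.\<close>

section \<open>Quotients and direct sums of vector spaces\<close>

text \<open>A coset depends only on the addition. The summands are quotients formed inside
  restrictions of \<open>spE X\<close>, and this lets their cosets be computed in
  \<open>spE X\<close> itself.\<close>

lemma a_r_coset_restrict [simp]: "W +>\<^bsub>V\<lparr>carrier := U\<rparr>\<^esub> v = W +>\<^bsub>V\<^esub> v"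
  by (simp add: a_r_coset_def r_coset_def)

text \<open>The summands of the complex are quotients of one subspace of \<open>spE X\<close> by a
  smaller one, so the smaller one must be seen as a subspace of the larger.\<close>

lemma subspace_restrict:
  assumes "subspace K W V" "subspace K U V" "W \<subseteq> U"
  shows "subspace K W (V\<lparr>carrier := U\<rparr>)"
proof -
  have vs: "vectorspace K V"
    using assms(1) by (simp add: subspace_def)
  interpret vectorspace K V by (fact vs)
  interpret W: submodule K W V using assms(1) by (simp add: subspace_def)
  interpret U: vectorspace K "V\<lparr>carrier := U\<rparr>" by (rule subspace_is_vs[OF assms(2)])
  show ?thesis
    by (intro subspace.intro submodule.intro U.vectorspace_axioms U.module_axioms) (use assms(3) in auto)
qed

lemma subspace_Int:
  assumes "subspace K U V" "subspace K W V"
  shows "subspace K (U \<inter> W) V"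
  using assms unfolding subspace_def submodule_def by auto

section \<open>Quotient spaces\<close>

context subspace
begin

sublocale vectorspace K V by (rule vs)
sublocale submodule K W V by (rule submod)

lemma abelian_subgroup: "abelian_subgroup W V"
proof (rule abelian_subgroupI3)
  show "additive_subgroup W V"
  proof (rule additive_subgroupI, rule M.add.subgroupI)
    show "W \<subseteq> carrier V" by (rule subset)
    show "W \<noteq> {}" using submodule.zero_closed[OF submod] by blast
    show "\<ominus>\<^bsub>V\<^esub> w \<in> W" if w: "w \<in> W" for w
    proof -
      \<comment> \<open>Subspaces are given by closure under sums and scalars; negation is scaling
        by minus one.\<close>
      have "w \<in> carrier V" using w subset by blast
      moreover have "(\<ominus>\<^bsub>K\<^esub> \<one>\<^bsub>K\<^esub>) \<odot>\<^bsub>V\<^esub> w \<in> W" using w by (intro smult_closed) auto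
      ultimately show ?thesis using smult_minus_1[of w] by simp
    qed
  qed auto
qed (rule M.abelian_group_axioms)

sublocale abelian_subgroup W V by (rule abelian_subgroup)

lemma quotient_carrier: "carrier (quotient_space V W) = (\<lambda>v. W +>\<^bsub>V\<^esub> v) ` carrier V"
  by (auto simp: quotient_space_def A_RCOSETS_def')

lemma quotient_zero: "\<zero>\<^bsub>quotient_space V W\<^esub> = W +>\<^bsub>V\<^esub> \<zero>\<^bsub>V\<^esub>"
  using subset by (simp add: quotient_space_def)

lemma quotient_add:
  assumes "x \<in> carrier V" "y \<in> carrier V"
  shows "(W +>\<^bsub>V\<^esub> x) \<oplus>\<^bsub>quotient_space V W\<^esub> (W +>\<^bsub>V\<^esub> y) = W +>\<^bsub>V\<^esub> (x \<oplus>\<^bsub>V\<^esub> y)"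
  using assms by (simp add: quotient_space_def a_rcos_sum)

text \<open>Replacing \<open>x\<close> by \<open>w \<oplus> x\<close> with \<open>w\<close> in
  \<open>W\<close> changes the multiple only by \<open>c \<odot> w\<close>, again in
  \<open>W\<close>. So all representatives contribute the same coset and the union in the definition
  collapses to it, also for \<open>c\<close> zero.\<close>

lemma quotient_smult:
  assumes c: "c \<in> carrier K" and x: "x \<in> carrier V"
  shows "c \<odot>\<^bsub>quotient_space V W\<^esub> (W +>\<^bsub>V\<^esub> x) = W +>\<^bsub>V\<^esub> (c \<odot>\<^bsub>V\<^esub> x)"
proof -
  have "W +>\<^bsub>V\<^esub> (c \<odot>\<^bsub>V\<^esub> y) = W +>\<^bsub>V\<^esub> (c \<odot>\<^bsub>V\<^esub> x)" if y: "y \<in> W +>\<^bsub>V\<^esub> x" for y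
  proof -
    obtain w where w: "w \<in> W" "y = w \<oplus>\<^bsub>V\<^esub> x"
      using y by (auto simp: a_r_coset_def')
    have "c \<odot>\<^bsub>V\<^esub> y = c \<odot>\<^bsub>V\<^esub> w \<oplus>\<^bsub>V\<^esub> c \<odot>\<^bsub>V\<^esub> x"
      using w c x subset by (auto simp: smult_r_distr)
    then have "c \<odot>\<^bsub>V\<^esub> y \<in> W +>\<^bsub>V\<^esub> (c \<odot>\<^bsub>V\<^esub> x)"
      using w c by (auto simp: a_r_coset_def')
    then show ?thesis
      using a_repr_independence'[of "c \<odot>\<^bsub>V\<^esub> y" "c \<odot>\<^bsub>V\<^esub> x"] c x by simp
  qed
  then have "(\<Union>y\<in>W +>\<^bsub>V\<^esub> x. W +>\<^bsub>V\<^esub> (c \<odot>\<^bsub>V\<^esub> y)) = (\<Union>y\<in>W +>\<^bsub>V\<^esub> x. W +>\<^bsub>V\<^esub> (c \<odot>\<^bsub>V\<^esub> x))"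
    by (intro SUP_cong refl)
  \<comment> \<open>The union of a constant family is that constant only over a nonempty index set;
    here \<open>x\<close> lies in its own coset.\<close>
  also have "\<dots> = W +>\<^bsub>V\<^esub> (c \<odot>\<^bsub>V\<^esub> x)"
    by (rule UN_constant[THEN trans]) (use a_rcos_self[OF x] in auto)
  finally show ?thesis
    by (simp add: quotient_space_def)
qed

lemma quotient_vectorspace: "vectorspace K (quotient_space V W)"
proof (intro vectorspace.intro moduleI abelian_groupI)
  let ?Q = "quotient_space V W"
  note Q = quotient_carrier quotient_zero quotient_add quotient_smult
  show "\<zero>\<^bsub>?Q\<^esub> \<in> carrier ?Q" by (auto simp: Q)
  show "\<exists>y\<in>carrier ?Q. y \<oplus>\<^bsub>?Q\<^esub> x = \<zero>\<^bsub>?Q\<^esub>" if x: "x \<in> carrier ?Q" for x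
  proof -
    obtain v where v: "v \<in> carrier V" "x = W +>\<^bsub>V\<^esub> v" using x by (auto simp: Q)
    show ?thesis
    proof (rule bexI[of _ "W +>\<^bsub>V\<^esub> (\<ominus>\<^bsub>V\<^esub> v)"])
      show "(W +>\<^bsub>V\<^esub> (\<ominus>\<^bsub>V\<^esub> v)) \<oplus>\<^bsub>?Q\<^esub> x = \<zero>\<^bsub>?Q\<^esub>"
        using v by (simp only: Q M.a_inv_closed M.l_neg)
      show "W +>\<^bsub>V\<^esub> (\<ominus>\<^bsub>V\<^esub> v) \<in> carrier ?Q"
        unfolding quotient_carrier using v by (intro imageI) simp
    qed
  qed
  show "field K" by (rule field_axioms)
\<comment> \<open>The zero of the quotient is kept as the coset of the zero of \<open>V\<close>, so
  that every operand is a coset with a visible representative and the axioms come from those of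
  \<open>V\<close>.\<close>
qed (unfold quotient_carrier, auto simp del: a_coset_add_zero
     simp: quotient_zero quotient_add quotient_smult smult_l_distr smult_r_distr smult_assoc1
      M.a_ac R.cring_axioms field_axioms)

end

section \<open>Direct sums of families\<close>

lemma direct_sum_family_vectorspace:
  assumes "field K" and V: "\<And>i. i \<in> I \<Longrightarrow> vectorspace K (V i)"
  shows "vectorspace K (direct_sum_family I V)"
proof (intro vectorspace.intro moduleI abelian_groupI)
  interpret K: field K by fact
  let ?S = "direct_sum_family I V"
  have M: "module K (V i)" if "i \<in> I" for i
    using V[OF that] by (simp add: vectorspace_def)
  have A: "abelian_group (V i)" if "i \<in> I" for i
    using M[OF that] by (simp add: module_def)
  note closed = abelian_groupE(1,2)[OF A] module.smult_closed[OF M]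
  show "field K" "cring K" by (rule \<open>field K\<close>, rule K.cring_axioms)
  \<comment> \<open>Elements are extensional functions on \<open>I\<close>, hence determined by
    their components; each equational axiom reduces to the same axiom in the summands.\<close>
  have eqI: "x = y" if "x \<in> carrier ?S" "y \<in> carrier ?S" "\<And>i. i \<in> I \<Longrightarrow> x i = y i" for x y
    using that by (auto simp: direct_sum_family_def PiE_def intro: extensionalityI)
  show add: "x \<oplus>\<^bsub>?S\<^esub> y \<in> carrier ?S" if "x \<in> carrier ?S" "y \<in> carrier ?S" for x y
  proof -
    have "finite ({i \<in> I. x i \<noteq> \<zero>\<^bsub>V i\<^esub>} \<union> {i \<in> I. y i \<noteq> \<zero>\<^bsub>V i\<^esub>})"
      using that by (auto simp: direct_sum_family_def)
    then have "finite {i \<in> I. x i \<oplus>\<^bsub>V i\<^esub> y i \<noteq> \<zero>\<^bsub>V i\<^esub>}"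
      by (rule rev_finite_subset) (auto simp: abelian_groupE(1,2,5)[OF A])
    then show ?thesis
      using that by (auto simp: direct_sum_family_def PiE_def Pi_def closed cong: conj_cong)
  qed
  show zero: "\<zero>\<^bsub>?S\<^esub> \<in> carrier ?S"
    by (auto simp: direct_sum_family_def closed)
  show smult: "c \<odot>\<^bsub>?S\<^esub> x \<in> carrier ?S" if "c \<in> carrier K" "x \<in> carrier ?S" for c x
  proof -
    have "finite {i \<in> I. x i \<noteq> \<zero>\<^bsub>V i\<^esub>}"
      using that by (auto simp: direct_sum_family_def)
    then have "finite {i \<in> I. c \<odot>\<^bsub>V i\<^esub> x i \<noteq> \<zero>\<^bsub>V i\<^esub>}"
      by (rule rev_finite_subset) (use that in \<open>auto simp: module.smult_r_null[OF M]\<close>)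
    then show ?thesis
      using that by (auto simp: direct_sum_family_def PiE_def Pi_def closed cong: conj_cong)
  qed
  show "\<exists>y\<in>carrier ?S. y \<oplus>\<^bsub>?S\<^esub> x = \<zero>\<^bsub>?S\<^esub>" if x: "x \<in> carrier ?S" for x
  proof (rule bexI)
    \<comment> \<open>Taking the negative as the multiple by minus one makes its finite support a
      case of \<open>smult\<close>.\<close>
    let ?y = "(\<ominus>\<^bsub>K\<^esub> \<one>\<^bsub>K\<^esub>) \<odot>\<^bsub>?S\<^esub> x"
    show y: "?y \<in> carrier ?S" by (rule smult) (use x in auto)
    show "?y \<oplus>\<^bsub>?S\<^esub> x = \<zero>\<^bsub>?S\<^esub>"
      by (rule eqI[OF add[OF y x] zero])
        (use x in \<open>auto simp: direct_sum_family_def module.smult_minus_1[OF M] PiE_def Pi_def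
          abelian_group.l_neg[OF A]\<close>)
  qed
  show "x \<oplus>\<^bsub>?S\<^esub> y = y \<oplus>\<^bsub>?S\<^esub> x" if "x \<in> carrier ?S" "y \<in> carrier ?S" for x y
    by (rule eqI[OF add add]) (use that in \<open>auto simp: direct_sum_family_def PiE_def Pi_def
          intro: abelian_groupE(4)[OF A]\<close>)
  show "x \<oplus>\<^bsub>?S\<^esub> y \<oplus>\<^bsub>?S\<^esub> z = x \<oplus>\<^bsub>?S\<^esub> (y \<oplus>\<^bsub>?S\<^esub> z)"
    if "x \<in> carrier ?S" "y \<in> carrier ?S" "z \<in> carrier ?S" for x y z
    by (rule eqI[OF add[OF add] add[OF _ add]])
      (use that in \<open>auto simp: direct_sum_family_def PiE_def Pi_def intro: abelian_groupE(3)[OF A]\<close>)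
  show "\<zero>\<^bsub>?S\<^esub> \<oplus>\<^bsub>?S\<^esub> x = x" if "x \<in> carrier ?S" for x
    by (rule eqI[OF add[OF zero]])
      (use that in \<open>auto simp: direct_sum_family_def PiE_def Pi_def intro: abelian_groupE(5)[OF A]\<close>)
  show "(c \<oplus>\<^bsub>K\<^esub> d) \<odot>\<^bsub>?S\<^esub> x = c \<odot>\<^bsub>?S\<^esub> x \<oplus>\<^bsub>?S\<^esub> d \<odot>\<^bsub>?S\<^esub> x"
    if "c \<in> carrier K" "d \<in> carrier K" "x \<in> carrier ?S" for c d x
    by (rule eqI[OF smult add[OF smult smult]])
      (use that in \<open>auto simp: direct_sum_family_def PiE_def Pi_def intro: module.smult_l_distr[OF M]\<close>)
  show "c \<odot>\<^bsub>?S\<^esub> (x \<oplus>\<^bsub>?S\<^esub> y) = c \<odot>\<^bsub>?S\<^esub> x \<oplus>\<^bsub>?S\<^esub> c \<odot>\<^bsub>?S\<^esub> y"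
    if "c \<in> carrier K" "x \<in> carrier ?S" "y \<in> carrier ?S" for c x y
    by (rule eqI[OF smult[OF _ add] add[OF smult smult]])
      (use that in \<open>auto simp: direct_sum_family_def PiE_def Pi_def intro: module.smult_r_distr[OF M]\<close>)
  show "(c \<otimes>\<^bsub>K\<^esub> d) \<odot>\<^bsub>?S\<^esub> x = c \<odot>\<^bsub>?S\<^esub> (d \<odot>\<^bsub>?S\<^esub> x)"
    if "c \<in> carrier K" "d \<in> carrier K" "x \<in> carrier ?S" for c d x
    by (rule eqI[OF smult smult[OF _ smult]])
      (use that in \<open>auto simp: direct_sum_family_def PiE_def Pi_def intro: module.smult_assoc1[OF M]\<close>)
  show "\<one>\<^bsub>K\<^esub> \<odot>\<^bsub>?S\<^esub> x = x" if "x \<in> carrier ?S" for x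
    by (rule eqI[OF smult])
      (use that in \<open>auto simp: direct_sum_family_def PiE_def Pi_def intro: module.smult_one[OF M]\<close>)
qed

section \<open>Graded linear maps\<close>

lemma (in mod_hom) finsum_hom:
  assumes "finite S" "c \<in> S \<rightarrow> carrier M"
  shows "f (\<Oplus>\<^bsub>M\<^esub>b\<in>S. c b) = (\<Oplus>\<^bsub>N\<^esub>b\<in>S. f (c b))"
  using assms by (induct rule: finite_induct) (auto simp: Pi_def)

lemmas (in abelian_monoid) finsum_mono_neutral_cong_left = add.finprod_mono_neutral_cong_left

lemma bigraded_spaceD:
  assumes "bigraded_space K V G"
  shows "vectorspace K V" "subspace K (G b) V" "v \<in> G b \<Longrightarrow> v \<in> carrier V"
proof -
  show *: "subspace K (G b) V"
    using assms unfolding bigraded_space_def by blast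
  then show "vectorspace K V" by (rule subspace.vs)
  show "v \<in> G b \<Longrightarrow> v \<in> carrier V"
    using submodule.subset[OF subspace.submod[OF *]] by blast
qed

text \<open>The homogeneous component of \<open>v\<close> works: the components of \<open>f v\<close> are the images of the components
  of \<open>v\<close>, and \<open>f v\<close> has only one.\<close>

lemma bigraded_linear_map_homogeneous_preimage:
  assumes V: "bigraded_space K V G" and W: "bigraded_space K W H"
    and f: "bigraded_linear_map K V G W H s f"
    and v: "v \<in> carrier V" and fv: "f v \<in> H (p + fst s, q + snd s)"
  shows "\<exists>u\<in>G (p, q). f u = f v"
proof -
  interpret linear_map K V W f using f by (simp add: bigraded_linear_map_def)
  have W_monoid: "abelian_monoid W" by unfold_locales
  define sh where "sh b = (fst b + fst s, snd b + snd s)" for b :: "int \<times> int"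
  define un where "un b = (fst b - fst s, snd b - snd s)" for b :: "int \<times> int"
  have un_sh: "un (sh b) = b" and sh_un: "sh (un b) = b" for b
    by (simp_all add: sh_def un_def)
  have f_gr: "f x \<in> H (sh b)" if "x \<in> G b" for x b
    using f that by (cases b) (auto simp: bigraded_linear_map_def sh_def)
  have H0: "\<zero>\<^bsub>W\<^esub> \<in> H b" for b
    using bigraded_spaceD(2)[OF W, of b] by (simp add: subspace_def submodule_def)
  obtain c where c: "\<And>b. c b \<in> G b" and fin: "finite {b. c b \<noteq> \<zero>\<^bsub>V\<^esub>}"
    and v_eq: "v = (\<Oplus>\<^bsub>V\<^esub>b\<in>{b. c b \<noteq> \<zero>\<^bsub>V\<^esub>}. c b)"
    using V v unfolding bigraded_space_def by blast
  define S where "S = {b. c b \<noteq> \<zero>\<^bsub>V\<^esub>}"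
  have cV: "c b \<in> carrier V" for b using bigraded_spaceD(3)[OF V] c by blast
  \<comment> \<open>Two decompositions of \<open>f v\<close> are compared: \<open>e\<close> is the
    decomposition of \<open>v\<close> pushed forward along the shift \<open>sh\<close>, and
    \<open>e'\<close> is concentrated in the single bidegree \<open>sh (p, q)\<close>.\<close>
  define e where "e b = f (c (un b))" for b
  define e' where "e' b = (if b = sh (p, q) then f v else \<zero>\<^bsub>W\<^esub>)" for b
  have eH: "e b \<in> H b" for b
    using f_gr[OF c, of "un b"] by (simp add: e_def sh_un)
  have eW: "e b \<in> carrier W" for b using bigraded_spaceD(3)[OF W eH] .
  have e'H: "e' b \<in> H b" for b
    using fv H0 by (simp add: e'_def sh_def)
  have supp: "{b. e b \<noteq> \<zero>\<^bsub>W\<^esub>} \<subseteq> sh ` S"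
  proof
    fix b assume "b \<in> {b. e b \<noteq> \<zero>\<^bsub>W\<^esub>}"
    then have "un b \<in> S" by (auto simp: e_def S_def)
    then show "b \<in> sh ` S" using sh_un[of b] by (metis imageI)
  qed
  have inj_sh: "inj_on sh S" using un_sh by (rule inj_on_inverseI)
  have finS: "finite S" using fin by (simp add: S_def)
  have finT: "finite {b. e b \<noteq> \<zero>\<^bsub>W\<^esub>}"
    by (rule finite_subset[OF supp]) (simp add: finS)
  have "f v = (\<Oplus>\<^bsub>W\<^esub>b\<in>S. f (c b))"
    unfolding v_eq S_def[symmetric] using finS cV by (intro finsum_hom) auto
  also have "\<dots> = (\<Oplus>\<^bsub>W\<^esub>b\<in>S. e (sh b))"
    by (simp add: e_def un_sh)
  also have "\<dots> = (\<Oplus>\<^bsub>W\<^esub>b\<in>sh ` S. e b)"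
    by (rule abelian_monoid.finsum_reindex[OF W_monoid, symmetric]) (use eW inj_sh in auto)
  \<comment> \<open>\<open>f\<close> may kill components of \<open>v\<close>, so the support of
    \<open>e\<close> can be smaller than the translate of \<open>S\<close>; the extra terms
    vanish.\<close>
  also have "\<dots> = (\<Oplus>\<^bsub>W\<^esub>b\<in>{b. e b \<noteq> \<zero>\<^bsub>W\<^esub>}. e b)"
    by (rule abelian_monoid.finsum_mono_neutral_cong_left[OF W_monoid, symmetric]) (use eW finS supp in auto)
  finally have e_sum: "f v = (\<Oplus>\<^bsub>W\<^esub>b\<in>{b. e b \<noteq> \<zero>\<^bsub>W\<^esub>}. e b)" .
  have e'_fin: "finite {b. e' b \<noteq> \<zero>\<^bsub>W\<^esub>}"
    by (rule finite_subset[of _ "{sh (p, q)}"]) (auto simp: e'_def)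
  have e'_sum: "f v = (\<Oplus>\<^bsub>W\<^esub>b\<in>{b. e' b \<noteq> \<zero>\<^bsub>W\<^esub>}. e' b)"
  \<comment> \<open>For \<open>f v\<close> zero the support of \<open>e'\<close> is empty instead of
    a singleton.\<close>
  proof (cases "f v = \<zero>\<^bsub>W\<^esub>")
    case True
    then show ?thesis by (simp add: e'_def)
  next
    case False
    then have "{b. e' b \<noteq> \<zero>\<^bsub>W\<^esub>} = {sh (p, q)}" by (auto simp: e'_def)
    then show ?thesis using v by (simp add: e'_def)
  qed
  have "\<exists>!c. (\<forall>b. c b \<in> H b) \<and> finite {b. c b \<noteq> \<zero>\<^bsub>W\<^esub>} \<and>
      f v = (\<Oplus>\<^bsub>W\<^esub>b\<in>{b. c b \<noteq> \<zero>\<^bsub>W\<^esub>}. c b)"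
    using W v by (simp add: bigraded_space_def)
  then have "e = e'"
    using eH finT e_sum e'H e'_fin e'_sum by blast
  then have "e (sh (p, q)) = e' (sh (p, q))" by simp
  then have "f (c (p, q)) = f v" by (simp add: e_def e'_def un_sh)
  then show ?thesis using c by blast
qed

section \<open>Composites and powers of graded maps\<close>

lemma bigraded_linear_map_id:
  assumes "bigraded_space K V G"
  shows "bigraded_linear_map K V G V G (0, 0) id"
proof -
  interpret vectorspace K V by (rule bigraded_spaceD[OF assms])
  have "linear_map K V V id"
    by unfold_locales (auto simp: module_hom_def)
  then show ?thesis by (simp add: bigraded_linear_map_def)
qed

lemma bigraded_linear_map_comp:
  assumes f: "bigraded_linear_map K V G W H s f" and g: "bigraded_linear_map K W H U J t g"
  shows "bigraded_linear_map K V G U J (fst s + fst t, snd s + snd t) (g \<circ> f)"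
proof -
  interpret f: linear_map K V W f using f by (simp add: bigraded_linear_map_def)
  interpret g: linear_map K W U g using g by (simp add: bigraded_linear_map_def)
  have "linear_map K V U (g \<circ> f)"
    by unfold_locales (auto simp: module_hom_def)
  moreover have "(g \<circ> f) ` G (p, q) \<subseteq> J (p + (fst s + fst t), q + (snd s + snd t))" for p q
  proof -
    have "f ` G (p, q) \<subseteq> H (p + fst s, q + snd s)"
      using f by (simp add: bigraded_linear_map_def)
    then have "(g \<circ> f) ` G (p, q) \<subseteq> g ` H (p + fst s, q + snd s)" by auto
    also have "\<dots> \<subseteq> J (p + fst s + fst t, q + snd s + snd t)"
      using g by (simp add: bigraded_linear_map_def)
    finally show ?thesis by (simp add: add.assoc)
  qed
  ultimately show ?thesis by (simp add: bigraded_linear_map_def)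
qed

text \<open>Meant for the map \<open>i\<close> of the couple: homogeneous lifts through a power of
  \<open>i\<close> require that the power be graded of a known bidegree.\<close>

lemma bigraded_linear_map_funpow:
  assumes "bigraded_space K V G" "bigraded_linear_map K V G V G s f"
  shows "bigraded_linear_map K V G V G (int r * fst s, int r * snd s) (f ^^ r)"
proof (induct r)
  case 0
  then show ?case using bigraded_linear_map_id[OF assms(1)] by (simp add: id_def)
next
  case (Suc r)
  then show ?case
    using bigraded_linear_map_comp[OF Suc assms(2)] by (simp add: algebra_simps comp_def)
qed

section \<open>Exact couples over a field\<close>

locale couple_over_field =
  fixes K :: "('f, 'k) ring_scheme" and a :: int and X :: "('f, 'd, 'e) couple"
  assumes K_field: "field K" and couple: "exact_couple K a X"
begin

abbreviation "D \<equiv> spD X"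
abbreviation "E \<equiv> spE X"
abbreviation "i \<equiv> map_i X"
abbreviation "j \<equiv> map_j X"
abbreviation "k \<equiv> map_k X"

lemma grading: "bigraded_space K D (grD X)" "bigraded_space K E (grE X)"
  and graded_i: "bigraded_linear_map K D (grD X) D (grD X) (1, -1) i"
  and graded_j: "bigraded_linear_map K D (grD X) E (grE X) (-a, a) j"
  and graded_k: "bigraded_linear_map K E (grE X) D (grD X) (-1, 0) k"
  using couple by (auto simp: exact_couple_def)

lemma graded_i_pow: "bigraded_linear_map K D (grD X) D (grD X) (int r, - int r) (i ^^ r)"
  using bigraded_linear_map_funpow[OF grading(1) graded_i, of r] by simp

sublocale i: linear_map K D D i using graded_i by (simp add: bigraded_linear_map_def)
sublocale j: linear_map K D E j using graded_j by (simp add: bigraded_linear_map_def)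
sublocale k: linear_map K E D k using graded_k by (simp add: bigraded_linear_map_def)

lemma D_group: "abelian_group D" and E_group: "abelian_group E"
  by unfold_locales

lemma i_pow_linear: "linear_map K D D (i ^^ r)"
  using graded_i_pow by (simp add: bigraded_linear_map_def)

lemma grE_subset: "x \<in> grE X b \<Longrightarrow> x \<in> carrier E"
  and grD_subset: "y \<in> grD X b \<Longrightarrow> y \<in> carrier D"
  using grading by (auto dest: bigraded_spaceD(3))

lemma j_degree: "x \<in> grD X (p, q) \<Longrightarrow> j x \<in> grE X (p - a, q + a)"
  using graded_j by (auto simp: bigraded_linear_map_def)

lemma k_degree: "x \<in> grE X (p, q) \<Longrightarrow> k x \<in> grD X (p - 1, q)"
  using graded_k by (auto simp: bigraded_linear_map_def)

section \<open>Exactness in terms of elements\<close>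

lemma exact_i: "{x \<in> carrier D. i x = \<zero>\<^bsub>D\<^esub>} = k ` carrier E"
  and exact_j: "{x \<in> carrier D. j x = \<zero>\<^bsub>E\<^esub>} = i ` carrier D"
  and exact_k: "{x \<in> carrier E. k x = \<zero>\<^bsub>D\<^esub>} = j ` carrier D"
  using couple i.ker_def j.ker_def k.ker_def by (auto simp: exact_couple_def)

lemma i_k [simp]: "x \<in> carrier E \<Longrightarrow> i (k x) = \<zero>\<^bsub>D\<^esub>"
  and j_i [simp]: "y \<in> carrier D \<Longrightarrow> j (i y) = \<zero>\<^bsub>E\<^esub>"
  and k_j [simp]: "y \<in> carrier D \<Longrightarrow> k (j y) = \<zero>\<^bsub>D\<^esub>"
  using exact_i exact_j exact_k by auto

section \<open>The two filtrations of \<open>E\<close>\<close>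

lemma B_space_eq: "B_space X r = j ` {x \<in> carrier D. (i ^^ r) x = \<zero>\<^bsub>D\<^esub>}"
proof -
  interpret linear_map K D D "i ^^ r" by (rule i_pow_linear)
  show ?thesis by (simp add: B_space_def ker_def)
qed

lemma B_subspace: "subspace K (B_space X r) E"
proof -
  interpret r: linear_map K D D "i ^^ r" by (rule i_pow_linear)
  show ?thesis
  proof (intro subspace.intro submodule.intro j.W.vectorspace_axioms vectorspace.axioms(1)[OF j.W.vectorspace_axioms])
    show "B_space X r \<subseteq> carrier E" by (auto simp: B_space_eq)
    show "v \<oplus>\<^bsub>E\<^esub> w \<in> B_space X r" if vw: "v \<in> B_space X r" "w \<in> B_space X r" for v w
    proof -
      obtain x y where "x \<in> carrier D" "y \<in> carrier D" "(i ^^ r) x = \<zero>\<^bsub>D\<^esub>" "(i ^^ r) y = \<zero>\<^bsub>D\<^esub>"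
        "v = j x" "w = j y"
        using vw by (auto simp: B_space_eq)
      then show ?thesis
        unfolding B_space_eq by (intro image_eqI[of _ _ "x \<oplus>\<^bsub>D\<^esub> y"]) auto
    qed
    show "\<zero>\<^bsub>E\<^esub> \<in> B_space X r"
      unfolding B_space_eq by (intro image_eqI[of _ _ "\<zero>\<^bsub>D\<^esub>"]) auto
    show "c \<odot>\<^bsub>E\<^esub> v \<in> B_space X r" if cv: "c \<in> carrier K" "v \<in> B_space X r" for c v
    proof -
      obtain x where "x \<in> carrier D" "(i ^^ r) x = \<zero>\<^bsub>D\<^esub>" "v = j x"
        using cv by (auto simp: B_space_eq)
      then show ?thesis
        unfolding B_space_eq using cv by (intro image_eqI[of _ _ "c \<odot>\<^bsub>D\<^esub> x"]) auto
    qed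
  qed
qed

lemma Z_subspace: "subspace K (Z_space X r) E"
proof -
  interpret r: linear_map K D D "i ^^ r" by (rule i_pow_linear)
  show ?thesis
  proof (intro subspace.intro submodule.intro j.W.vectorspace_axioms vectorspace.axioms(1)[OF j.W.vectorspace_axioms])
    show "Z_space X r \<subseteq> carrier E" by (auto simp: Z_space_def)
    show "v \<oplus>\<^bsub>E\<^esub> w \<in> Z_space X r" if vw: "v \<in> Z_space X r" "w \<in> Z_space X r" for v w
    proof -
      obtain x y where "x \<in> carrier D" "y \<in> carrier D" "k v = (i ^^ r) x" "k w = (i ^^ r) y"
        "v \<in> carrier E" "w \<in> carrier E"
        using vw by (auto simp: Z_space_def)
      then show ?thesis
        by (auto simp: Z_space_def intro!: image_eqI[of _ _ "x \<oplus>\<^bsub>D\<^esub> y"])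
    qed
    show "\<zero>\<^bsub>E\<^esub> \<in> Z_space X r"
      by (auto simp: Z_space_def intro!: image_eqI[of _ _ "\<zero>\<^bsub>D\<^esub>"])
    show "c \<odot>\<^bsub>E\<^esub> v \<in> Z_space X r" if cv: "c \<in> carrier K" "v \<in> Z_space X r" for c v
    proof -
      obtain x where "x \<in> carrier D" "k v = (i ^^ r) x" "v \<in> carrier E"
        using cv by (auto simp: Z_space_def)
      then show ?thesis
        using cv by (auto simp: Z_space_def intro!: image_eqI[of _ _ "c \<odot>\<^bsub>D\<^esub> x"])
    qed
  qed
qed

text \<open>The kernels of the powers of \<open>i\<close> increase, because \<open>i\<close> maps
  zero to zero.\<close>

lemma B_Suc_subset: "B_space X r \<subseteq> B_space X (r + 1)"
  by (auto simp: B_space_eq)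

text \<open>The images of the powers of \<open>i\<close> decrease: one factor \<open>i\<close> can
  be moved into the argument.\<close>

lemma Z_Suc_subset: "Z_space X (r + 1) \<subseteq> Z_space X r"
  by (auto simp: Z_space_def funpow_swap1)

text \<open>Since \<open>k\<close> kills the image of \<open>j\<close>, it sends all of
  \<open>B_space X r\<close> to zero, which lies in the image of every power of \<open>i\<close>.
  The two indices are therefore independent.\<close>

lemma B_subset_Z: "B_space X r \<subseteq> Z_space X r'"
proof -
  interpret r: linear_map K D D "i ^^ r'" by (rule i_pow_linear)
  show ?thesis
    by (auto simp: B_space_eq Z_space_def intro!: image_eqI[of _ _ "\<zero>\<^bsub>D\<^esub>"])
qed

section \<open>Homogeneous parts of the filtrations and the summands built from them\<close>

lemma B_comp_subspace: "subspace K (B_comp X r b) E"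
  and Z_comp_subspace: "subspace K (Z_comp X r b) E"
  unfolding B_comp_def Z_comp_def
  using subspace_Int B_subspace Z_subspace bigraded_spaceD(2)[OF grading(2)] by blast+

lemma B_comp_subspace_Suc: "subspace K (B_comp X r b) (E\<lparr>carrier := B_comp X (r + 1) b\<rparr>)"
  by (rule subspace_restrict[OF B_comp_subspace B_comp_subspace])
    (use B_Suc_subset in \<open>auto simp: B_comp_def\<close>)

lemma Z_comp_Suc_subspace: "subspace K (Z_comp X (r + 1) b) (E\<lparr>carrier := Z_comp X r b\<rparr>)"
  by (rule subspace_restrict[OF Z_comp_subspace Z_comp_subspace])
    (use Z_Suc_subset in \<open>auto simp: Z_comp_def\<close>)

lemma B_comp_subspace_Z_comp: "subspace K (B_comp X r b) (E\<lparr>carrier := Z_comp X r b\<rparr>)"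
  by (rule subspace_restrict[OF B_comp_subspace Z_comp_subspace])
    (use B_subset_Z in \<open>auto simp: B_comp_def Z_comp_def\<close>)

lemma slot_vectorspace: "vectorspace K (slot_space X N b s)"
  by (cases s) (auto intro: subspace.quotient_vectorspace[OF B_comp_subspace_Suc]
      subspace.quotient_vectorspace[OF Z_comp_Suc_subspace]
      subspace.quotient_vectorspace[OF B_comp_subspace_Z_comp] simp del: add_Suc_right One_nat_def)

lemma total_vectorspace: "vectorspace K (total_space X N l)"
  unfolding total_space_def
  by (intro direct_sum_family_vectorspace K_field slot_vectorspace)

text \<open>Another choice of \<open>\<alpha>\<close> and \<open>x\<close> changes \<open>x\<close> by an element of \<open>im i + ker i\<^sup>r\<close>, and \<open>j\<close> sends
  this sum into \<open>B\<^sup>r\<close>.\<close>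

lemma dbar_eq:
  assumes A: "A \<subseteq> Z_space X (r + 1) +>\<^bsub>E\<^esub> \<alpha>" "\<alpha> \<in> A" "\<alpha> \<in> carrier E"
    and x: "x \<in> carrier D" "k \<alpha> = (i ^^ r) x"
  shows "dbar X r A = B_space X r +>\<^bsub>E\<^esub> j x"
proof -
  interpret r: linear_map K D D "i ^^ r" by (rule i_pow_linear)
  interpret B: subspace K "B_space X r" E by (rule B_subspace)
  show ?thesis
    unfolding dbar_def
  proof (rule the_equality)
    show "\<exists>\<beta>\<in>A. \<exists>y\<in>carrier D. k \<beta> = (i ^^ r) y \<and> B_space X r +>\<^bsub>E\<^esub> j x = B_space X r +>\<^bsub>E\<^esub> j y"
      using assms by blast
  next
    fix Y
    assume "\<exists>\<beta>\<in>A. \<exists>y\<in>carrier D. k \<beta> = (i ^^ r) y \<and> Y = B_space X r +>\<^bsub>E\<^esub> j y"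
    then obtain \<beta> y where \<beta>: "\<beta> \<in> A" and y: "y \<in> carrier D" "k \<beta> = (i ^^ r) y"
      and Y: "Y = B_space X r +>\<^bsub>E\<^esub> j y" by blast
    obtain z where z: "z \<in> Z_space X (r + 1)" "\<beta> = z \<oplus>\<^bsub>E\<^esub> \<alpha>"
      using \<beta> A(1) by (auto simp: a_r_coset_def')
    \<comment> \<open>Membership in \<open>Z_space X (r + 1)\<close>, not just in
      \<open>Z_space X r\<close>, provides one more factor \<open>i\<close>; it is moved inside so
      that \<open>j\<close> can kill \<open>i w\<close>.\<close>
    obtain w where w: "w \<in> carrier D" "k z = (i ^^ r) (i w)" "z \<in> carrier E"
      using z(1) by (auto simp: Z_space_def funpow_swap1)
    define u where "u = y \<ominus>\<^bsub>D\<^esub> (i w \<oplus>\<^bsub>D\<^esub> x)"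
    have "(i ^^ r) (i w \<oplus>\<^bsub>D\<^esub> x) = (i ^^ r) y"
      using y w z x A(3) by simp
    then have "(i ^^ r) u = \<zero>\<^bsub>D\<^esub>"
      using y w x abelian_group.r_neg[OF D_group, of "(i ^^ r) y"] r.f_minus[of y "i w \<oplus>\<^bsub>D\<^esub> x"]
      by (simp add: u_def a_minus_def)
    moreover have "u \<in> carrier D" using y w x by (simp add: u_def)
    ultimately have "j u \<in> B_space X r" by (auto simp: B_space_eq)
    moreover have "j u = j y \<ominus>\<^bsub>E\<^esub> j x"
      using y w x by (simp add: u_def)
    ultimately have "j y \<in> B_space X r +>\<^bsub>E\<^esub> j x"
      using y x by (simp add: B.a_rcos_module a_minus_def)
    then show "Y = B_space X r +>\<^bsub>E\<^esub> j x"
      unfolding Y using x by (intro B.a_repr_independence'[symmetric]) auto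
  qed
qed

end

section \<open>The differential in a single bidegree\<close>

context couple_over_field
begin

text \<open>As \<open>w\<close> has bidegree \<open>b\<close>, an element \<beta> of
  \<open>B_space X r\<close> has bidegree \<open>b\<close> exactly when its sum with
  \<open>w\<close> does. This justifies the intersection with a graded piece in
  \<open>dbar_comp\<close>.\<close>

lemma homogeneous_coset:
  assumes w: "w \<in> grE X b"
  shows "(B_space X r +>\<^bsub>E\<^esub> w) \<inter> grE X b = B_comp X r b +>\<^bsub>E\<^esub> w"
proof -
  interpret B: subspace K "B_space X r" E by (rule B_subspace)
  interpret G: subspace K "grE X b" E by (rule bigraded_spaceD(2)[OF grading(2)])
  have wE: "w \<in> carrier E" using w by (rule grE_subset)
  have "\<beta> \<in> grE X b \<longleftrightarrow> \<beta> \<oplus>\<^bsub>E\<^esub> w \<in> grE X b" if \<beta>: "\<beta> \<in> B_space X r" for \<beta>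
  proof
    show "\<beta> \<oplus>\<^bsub>E\<^esub> w \<in> grE X b" if "\<beta> \<in> grE X b"
      using that w by (rule G.m_closed)
    have \<beta>E: "\<beta> \<in> carrier E" using \<beta> B.subset by blast
    show "\<beta> \<in> grE X b" if "\<beta> \<oplus>\<^bsub>E\<^esub> w \<in> grE X b"
    proof -
      have "(\<beta> \<oplus>\<^bsub>E\<^esub> w) \<oplus>\<^bsub>E\<^esub> (\<ominus>\<^bsub>E\<^esub> w) \<in> grE X b"
        by (rule submodule.m_closed[OF G.submod that
              additive_subgroup.a_inv_closed[OF G.additive_subgroup_axioms w]])
      moreover have "\<beta> \<oplus>\<^bsub>E\<^esub> w \<oplus>\<^bsub>E\<^esub> (\<ominus>\<^bsub>E\<^esub> w) = \<beta>"
        using abelian_groupE(3)[OF E_group \<beta>E wE] abelian_group.r_neg[OF E_group wE] \<beta>E wE by simp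
      ultimately show ?thesis by (simp only:)
    qed
  qed
  then show ?thesis
    by (auto simp: B_comp_def a_r_coset_def')
qed

text \<open>An arbitrary lift of \<open>k \<alpha>\<close> may be inhomogeneous. But
  \<open>k \<alpha>\<close> has bidegree \<open>(p - 1, q)\<close> and \<open>i ^^ r\<close> shifts
  by \<open>(r, -r)\<close>, so the component of the lift in bidegree
  \<open>(p - 1 - r, q + r)\<close> already lifts it.\<close>

lemma Z_comp_lift:
  assumes "\<alpha> \<in> Z_comp X r (p, q)"
  shows "\<exists>x\<in>grD X (p - 1 - int r, q + int r). k \<alpha> = (i ^^ r) x"
proof -
  obtain y where y: "y \<in> carrier D" "k \<alpha> = (i ^^ r) y"
    using assms by (auto simp: Z_comp_def Z_space_def)
  have "(i ^^ r) y \<in> grD X (p - 1, q)"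
    using k_degree[of \<alpha> p q] assms y(2) by (simp add: Z_comp_def)
  then obtain x where "x \<in> grD X (p - 1 - int r, q + int r)" "(i ^^ r) x = (i ^^ r) y"
    using bigraded_linear_map_homogeneous_preimage[OF grading(1,1) graded_i_pow y(1),
        of r "p - 1 - int r" "q + int r"] by auto
  then show ?thesis using y(2) by metis
qed

text \<open>Enlarging the coset to one of \<open>Z_space X (r + 1)\<close> brings it within reach of
  \<open>dbar_eq\<close>, and \<open>homogeneous_coset\<close> cuts the resulting coset back to one
  bidegree. Any homogeneous pair \<alpha>, \<open>x\<close> may thus be used to evaluate the
  differential.\<close>

lemma dbar_comp_eq:
  assumes \<alpha>: "\<alpha> \<in> grE X (p, q)" and x: "x \<in> grD X (p - 1 - int r, q + int r)"
    and k\<alpha>: "k \<alpha> = (i ^^ r) x"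
  shows "dbar_comp a X r (p, q) (Z_comp X (r + 1) (p, q) +>\<^bsub>E\<^esub> \<alpha>) =
    B_comp X r (p - (a + int r) - 1, q + (a + int r)) +>\<^bsub>E\<^esub> j x"
proof -
  interpret Z: subspace K "Z_space X (r + 1)" E by (rule Z_subspace)
  interpret Zc: subspace K "Z_comp X (r + 1) (p, q)" E by (rule Z_comp_subspace)
  let ?A = "Z_space X (r + 1) <+>\<^bsub>E\<^esub> (Z_comp X (r + 1) (p, q) +>\<^bsub>E\<^esub> \<alpha>)"
  have \<alpha>E: "\<alpha> \<in> carrier E" using \<alpha> by (rule grE_subset)
  \<comment> \<open>Besides containing \<alpha>, the set only has to lie within one coset of
    \<open>Z_space X (r + 1)\<close> for \<open>dbar_eq\<close> to apply.\<close>
  have "?A \<subseteq> Z_space X (r + 1) +>\<^bsub>E\<^esub> \<alpha>"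
  proof
    fix y assume "y \<in> ?A"
    then obtain z z' where z: "z \<in> Z_space X (r + 1)" "z' \<in> Z_space X (r + 1)"
      and y: "y = z \<oplus>\<^bsub>E\<^esub> (z' \<oplus>\<^bsub>E\<^esub> \<alpha>)"
      by (auto simp: set_add_def' a_r_coset_def' Z_comp_def)
    have "y = (z \<oplus>\<^bsub>E\<^esub> z') \<oplus>\<^bsub>E\<^esub> \<alpha>"
      unfolding y using z \<alpha>E Z.subset by (intro abelian_groupE(3)[OF E_group, symmetric]) auto
    then show "y \<in> Z_space X (r + 1) +>\<^bsub>E\<^esub> \<alpha>"
      using z Z.m_closed by (auto simp: a_r_coset_def')
  qed
  moreover have "\<alpha> \<in> ?A"
  proof -
    have "\<zero>\<^bsub>E\<^esub> \<oplus>\<^bsub>E\<^esub> \<alpha> \<in> ?A"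
      unfolding set_add_def' using Zc.a_rcos_self[OF \<alpha>E] submodule.zero_closed[OF Z.submod] by blast
    then show ?thesis using \<alpha>E by simp
  qed
  ultimately have "dbar X r ?A = B_space X r +>\<^bsub>E\<^esub> j x"
    using \<alpha>E grD_subset[OF x] k\<alpha> by (rule dbar_eq)
  moreover have "j x \<in> grE X (p - (a + int r) - 1, q + (a + int r))"
    using j_degree[OF x] by (simp add: algebra_simps)
  ultimately show ?thesis
    by (simp add: dbar_comp_def homogeneous_coset)
qed

lemma dbar_comp_linear:
  "linear_map K (slot_space X N (p, q) (Zquot r))
     (slot_space X N (p - (a + int r) - 1, q + (a + int r)) (Bquot r)) (dbar_comp a X r (p, q))"
proof -
  define b' where "b' = (p - (a + int r) - 1, q + (a + int r))"
  interpret r: linear_map K D D "i ^^ r" by (rule i_pow_linear)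
  interpret Z: subspace K "Z_comp X (r + 1) (p, q)" "E\<lparr>carrier := Z_comp X r (p, q)\<rparr>"
    by (rule Z_comp_Suc_subspace)
  interpret B: subspace K "B_comp X r b'" "E\<lparr>carrier := B_comp X (r + 1) b'\<rparr>"
    by (rule B_comp_subspace_Suc)
  interpret GD: subspace K "grD X (p - 1 - int r, q + int r)" D
    by (rule bigraded_spaceD(2)[OF grading(1)])
  interpret Zr: subspace K "Z_comp X r (p, q)" E by (rule Z_comp_subspace)
  let ?Z = "quotient_space (E\<lparr>carrier := Z_comp X r (p, q)\<rparr>) (Z_comp X (r + 1) (p, q))"
  let ?B = "quotient_space (E\<lparr>carrier := B_comp X (r + 1) b'\<rparr>) (B_comp X r b')"
  let ?d = "dbar_comp a X r (p, q)"
  \<comment> \<open>Such pairs are closed under sums and scalar multiples, and every class of the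
    source is represented by one. Linearity can therefore be checked on pairs, where it is the
    linearity of \<open>j\<close>.\<close>
  let ?lift = "\<lambda>\<alpha> x. \<alpha> \<in> Z_comp X r (p, q) \<and> x \<in> grD X (p - 1 - int r, q + int r) \<and>
    k \<alpha> = (i ^^ r) x"
  have lift: "\<exists>\<alpha> x. A = Z_comp X (r + 1) (p, q) +>\<^bsub>E\<^esub> \<alpha> \<and> ?lift \<alpha> x" if A: "A \<in> carrier ?Z" for A
  proof -
    obtain \<alpha> where \<alpha>: "\<alpha> \<in> Z_comp X r (p, q)" "A = Z_comp X (r + 1) (p, q) +>\<^bsub>E\<^esub> \<alpha>"
      using A unfolding Z.quotient_carrier by auto
    with Z_comp_lift[OF \<alpha>(1)] show ?thesis by blast
  qed
  have d_eq: "?d (Z_comp X (r + 1) (p, q) +>\<^bsub>E\<^esub> \<alpha>) = B_comp X r b' +>\<^bsub>E\<^esub> j x" if "?lift \<alpha> x" for \<alpha> x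
    unfolding b'_def using that by (intro dbar_comp_eq) (auto simp: Z_comp_def)
  have lift_D: "\<alpha> \<in> carrier E" "x \<in> carrier D" if "?lift \<alpha> x" for \<alpha> x
    using that grE_subset[of \<alpha> "(p, q)"] grD_subset[of x "(p - 1 - int r, q + int r)"]
    by (simp_all add: Z_comp_def)
  have j_lift: "j x \<in> B_comp X (r + 1) b'" if "?lift \<alpha> x" for \<alpha> x
  proof -
    have "i ((i ^^ r) x) = \<zero>\<^bsub>D\<^esub>"
      using that lift_D[OF that] i_k[of \<alpha>] by simp
    then have "j x \<in> B_space X (r + 1)"
      using lift_D[OF that] by (auto simp: B_space_eq)
    moreover have "j x \<in> grE X b'"
      using that j_degree[of x "p - 1 - int r" "q + int r"] by (simp add: b'_def algebra_simps)
    ultimately show ?thesis by (simp add: B_comp_def)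
  qed
  \<comment> \<open>The operations of both quotients, restated with cosets taken in \<open>E\<close>
    instead of in its restrictions.\<close>
  note Z_add = Z.quotient_add[simplified]
    and Z_smult = Z.quotient_smult[simplified]
    and B_add = B.quotient_add[simplified]
    and B_smult = B.quotient_smult[simplified]
  have "linear_map K ?Z ?B ?d"
  proof (intro linear_map.intro mod_hom.intro mod_hom_axioms.intro Z.quotient_vectorspace
      B.quotient_vectorspace vectorspace.axioms(1)[OF Z.quotient_vectorspace]
      vectorspace.axioms(1)[OF B.quotient_vectorspace])
    have closed: "?d A \<in> carrier ?B" if "A \<in> carrier ?Z" for A
      using lift[OF that] d_eq j_lift unfolding B.quotient_carrier by fastforce
    have add: "?d (A \<oplus>\<^bsub>?Z\<^esub> A') = ?d A \<oplus>\<^bsub>?B\<^esub> ?d A'" if A: "A \<in> carrier ?Z" "A' \<in> carrier ?Z" for A A'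
    proof -
      obtain \<alpha> x \<alpha>' x' where *: "A = Z_comp X (r + 1) (p, q) +>\<^bsub>E\<^esub> \<alpha>" "?lift \<alpha> x"
        "A' = Z_comp X (r + 1) (p, q) +>\<^bsub>E\<^esub> \<alpha>'" "?lift \<alpha>' x'"
        using A lift by meson
      note D = lift_D[OF *(2)] lift_D[OF *(4)]
      have "?lift (\<alpha> \<oplus>\<^bsub>E\<^esub> \<alpha>') (x \<oplus>\<^bsub>D\<^esub> x')"
        using * D by (simp add: Zr.m_closed GD.m_closed)
      then show ?thesis
        using D * j_lift[OF *(2)] j_lift[OF *(4)] d_eq[OF *(2)] d_eq[OF *(4)]
          d_eq[of "\<alpha> \<oplus>\<^bsub>E\<^esub> \<alpha>'" "x \<oplus>\<^bsub>D\<^esub> x'"] Z_add[of \<alpha> \<alpha>'] B_add[of "j x" "j x'"]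
        by simp
    qed
    have smult: "?d (c \<odot>\<^bsub>?Z\<^esub> A) = c \<odot>\<^bsub>?B\<^esub> ?d A" if A: "c \<in> carrier K" "A \<in> carrier ?Z" for c A
    proof -
      obtain \<alpha> x where *: "A = Z_comp X (r + 1) (p, q) +>\<^bsub>E\<^esub> \<alpha>" "?lift \<alpha> x"
        using lift[OF A(2)] by blast
      note D = lift_D[OF *(2)]
      have "?lift (c \<odot>\<^bsub>E\<^esub> \<alpha>) (c \<odot>\<^bsub>D\<^esub> x)"
        using A(1) * D by (simp add: Zr.smult_closed GD.smult_closed)
      then show ?thesis
        using A(1) D * j_lift[OF *(2)] d_eq[OF *(2)] d_eq[of "c \<odot>\<^bsub>E\<^esub> \<alpha>" "c \<odot>\<^bsub>D\<^esub> x"]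
          Z_smult[of c \<alpha>] B_smult[of c "j x"]
        by simp
    qed
    show "?d \<in> module_hom K ?Z ?B"
      using closed add smult by (simp add: module_hom_def)
  qed
  then show ?thesis by (simp add: b'_def)
qed

text \<open>The same map indexed by the bidegree of its target, which is how
  \<open>total_diff\<close> refers to it.\<close>

lemma dbar_comp_linear_into:
  "linear_map K (slot_space X N (p + (a + int r) + 1, q - (a + int r)) (Zquot r))
     (slot_space X N (p, q) (Bquot r)) (dbar_comp a X r (p + (a + int r) + 1, q - (a + int r)))"
proof -
  have "p + (a + int r) + 1 - (a + int r) - 1 = p" "q - (a + int r) + (a + int r) = q" by simp_all
  then show ?thesis
    using dbar_comp_linear[of N "p + (a + int r) + 1" "q - (a + int r)" r] by (simp only:)
qed

section \<open>The total complex\<close>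

text \<open>Flattens the nested direct sum. There are finitely many slots, so finite support within
  one bidegree is automatic, and only the set of bidegrees with some nonzero slot has to be
  finite.\<close>

lemma total_carrier_iff:
  "x \<in> carrier (total_space X N l) \<longleftrightarrow>
    x \<in> extensional {(p, q). p + q = l} \<and>
    (\<forall>p q. p + q = l \<longrightarrow> x (p, q) \<in> extensional (slots N) \<and>
      (\<forall>s\<in>slots N. x (p, q) s \<in> carrier (slot_space X N (p, q) s))) \<and>
    finite {(p, q). p + q = l \<and> (\<exists>s\<in>slots N. x (p, q) s \<noteq> \<zero>\<^bsub>slot_space X N (p, q) s\<^esub>)}"
  (is "_ \<longleftrightarrow> _ \<and> ?comp \<and> finite ?S")
proof -
  have fin: "finite (slots N)" by (simp add: slots_def)
  \<comment> \<open>By extensionality in the slots, a family at one bidegree differs from the zero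
    family exactly when one of its slots is nonzero.\<close>
  have "{b \<in> {(p, q). p + q = l}. x b \<noteq> (\<lambda>s\<in>slots N. \<zero>\<^bsub>slot_space X N b s\<^esub>)} = ?S" if ?comp
  proof (rule Set.set_eqI)
    fix b
    show "b \<in> {b \<in> {(p, q). p + q = l}. x b \<noteq> (\<lambda>s\<in>slots N. \<zero>\<^bsub>slot_space X N b s\<^esub>)} \<longleftrightarrow> b \<in> ?S"
    proof (cases "b \<in> {(p, q). p + q = l}")
      case True
      then have "x b \<in> extensional (slots N)" using that by auto
      then have "x b = (\<lambda>s\<in>slots N. \<zero>\<^bsub>slot_space X N b s\<^esub>) \<longleftrightarrow>
          (\<forall>s\<in>slots N. x b s = \<zero>\<^bsub>slot_space X N b s\<^esub>)"
        by (auto intro: extensionalityI)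
      then show ?thesis using True by (cases b) auto
    qed auto
  qed
  then show ?thesis
    using fin by (auto simp: total_space_def direct_sum_family_def PiE_def Pi_def)
qed

lemma total_carrierE:
  assumes "x \<in> carrier (total_space X N l)" "p + q = l" "s \<in> slots N"
  shows "x (p, q) s \<in> carrier (slot_space X N (p, q) s)"
  using assms by (simp add: total_carrier_iff)

lemma total_eqI:
  assumes "x \<in> carrier (total_space X N l)" "y \<in> carrier (total_space X N l)"
    and "\<And>p q s. p + q = l \<Longrightarrow> s \<in> slots N \<Longrightarrow> x (p, q) s = y (p, q) s"
  shows "x = y"
proof (rule extensionalityI)
  show "x b = y b" if "b \<in> {(p, q). p + q = l}" for b
    by (rule extensionalityI[of _ "slots N"]) (use that assms in \<open>auto simp: total_carrier_iff\<close>)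
qed (use assms in \<open>auto simp: total_carrier_iff\<close>)

lemma total_ops:
  assumes "p + q = l" "s \<in> slots N"
  shows "(x \<oplus>\<^bsub>total_space X N l\<^esub> y) (p, q) s = x (p, q) s \<oplus>\<^bsub>slot_space X N (p, q) s\<^esub> y (p, q) s"
    and "(c \<odot>\<^bsub>total_space X N l\<^esub> x) (p, q) s = c \<odot>\<^bsub>slot_space X N (p, q) s\<^esub> x (p, q) s"
    and "\<zero>\<^bsub>total_space X N l\<^esub> (p, q) s = \<zero>\<^bsub>slot_space X N (p, q) s\<^esub>"
  using assms by (simp_all add: total_space_def direct_sum_family_def)

section \<open>The total differential by coordinates\<close>

lemma total_diff_Bquot:
  assumes "p + q = l - 1" "Bquot r \<in> slots N"
  shows "total_diff a X N l x (p, q) (Bquot r) =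
    dbar_comp a X r (p + (a + int r) + 1, q - (a + int r))
      (x (p + (a + int r) + 1, q - (a + int r)) (Zquot r))"
  using assms by (simp add: total_diff_def Let_def)

lemma total_diff_not_Bquot:
  assumes "p + q = l - 1" "s \<in> slots N" "\<nexists>r. s = Bquot r"
  shows "total_diff a X N l x (p, q) s = \<zero>\<^bsub>slot_space X N (p, q) s\<^esub>"
  using assms by (auto simp: total_diff_def split: slot.split)

lemma slots_simps [simp]:
  "Bquot r \<in> slots N \<longleftrightarrow> r < N" "Zquot r \<in> slots N \<longleftrightarrow> r < N" "Middle \<in> slots N"
  by (auto simp: slots_def)

text \<open>Serves the slots \<open>Middle\<close> and \<open>Zquot r\<close>, which the
  differential does not reach: there closure and linearity amount to these facts about zero.\<close>

lemma slot_zero: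
  "\<zero>\<^bsub>slot_space X N b s\<^esub> \<in> carrier (slot_space X N b s)"
  "\<zero>\<^bsub>slot_space X N b s\<^esub> \<oplus>\<^bsub>slot_space X N b s\<^esub> \<zero>\<^bsub>slot_space X N b s\<^esub> = \<zero>\<^bsub>slot_space X N b s\<^esub>"
  "c \<in> carrier K \<Longrightarrow> c \<odot>\<^bsub>slot_space X N b s\<^esub> \<zero>\<^bsub>slot_space X N b s\<^esub> = \<zero>\<^bsub>slot_space X N b s\<^esub>"
proof -
  interpret vectorspace K "slot_space X N b s" by (rule slot_vectorspace)
  show "\<zero>\<^bsub>slot_space X N b s\<^esub> \<in> carrier (slot_space X N b s)"
    "\<zero>\<^bsub>slot_space X N b s\<^esub> \<oplus>\<^bsub>slot_space X N b s\<^esub> \<zero>\<^bsub>slot_space X N b s\<^esub> = \<zero>\<^bsub>slot_space X N b s\<^esub>"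
    "c \<in> carrier K \<Longrightarrow> c \<odot>\<^bsub>slot_space X N b s\<^esub> \<zero>\<^bsub>slot_space X N b s\<^esub> = \<zero>\<^bsub>slot_space X N b s\<^esub>"
    by simp_all
qed

text \<open>Linearity of the component. It is used both to bound the support of the image of
  \<open>total_diff\<close> and to see that applying the differential twice gives zero.\<close>

lemma dbar_comp_zero:
  "dbar_comp a X r (p + (a + int r) + 1, q - (a + int r))
     \<zero>\<^bsub>slot_space X N (p + (a + int r) + 1, q - (a + int r)) (Zquot r)\<^esub> =
   \<zero>\<^bsub>slot_space X N (p, q) (Bquot r)\<^esub>"
proof -
  interpret d: linear_map K "slot_space X N (p + (a + int r) + 1, q - (a + int r)) (Zquot r)"
    "slot_space X N (p, q) (Bquot r)" "dbar_comp a X r (p + (a + int r) + 1, q - (a + int r))"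
    by (rule dbar_comp_linear_into)
  show ?thesis by (rule d.f0_is_0)
qed

lemma total_diff_closed:
  assumes x: "x \<in> carrier (total_space X N l)"
  shows "total_diff a X N l x \<in> carrier (total_space X N (l - 1))"
proof -
  let ?d = "total_diff a X N l x"
  let ?S = "{(p, q). p + q = l \<and> (\<exists>s\<in>slots N. x (p, q) s \<noteq> \<zero>\<^bsub>slot_space X N (p, q) s\<^esub>)}"
  let ?T = "{(p, q). p + q = l - 1 \<and> (\<exists>s\<in>slots N. ?d (p, q) s \<noteq> \<zero>\<^bsub>slot_space X N (p, q) s\<^esub>)}"
  \<comment> \<open>For each \<open>r\<close> below \<open>N\<close>, the coordinates
    \<open>Bquot r\<close> of the image come from one translate of the support of \<open>x\<close>;
    finitely many translates of a finite set cover the support of the image.\<close>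
  have "?T \<subseteq> (\<Union>r<N. (\<lambda>(p, q). (p - (a + int r) - 1, q + (a + int r))) ` ?S)"
  proof
    fix b assume "b \<in> ?T"
    then obtain p q s where b: "b = (p, q)" "p + q = l - 1" "s \<in> slots N"
      "?d (p, q) s \<noteq> \<zero>\<^bsub>slot_space X N (p, q) s\<^esub>" by auto
    have "\<exists>r. s = Bquot r"
      using total_diff_not_Bquot[OF b(2,3)] b(4) by blast
    with b(3) obtain r where r: "s = Bquot r" "r < N" by auto
    let ?b = "(p + (a + int r) + 1, q - (a + int r))"
    have "x ?b (Zquot r) \<noteq> \<zero>\<^bsub>slot_space X N ?b (Zquot r)\<^esub>"
    proof
      assume *: "x ?b (Zquot r) = \<zero>\<^bsub>slot_space X N ?b (Zquot r)\<^esub>"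
      have "?d (p, q) s = dbar_comp a X r ?b (x ?b (Zquot r))"
        using total_diff_Bquot[OF b(2), of r N x] b(3) r(1) by simp
      also have "\<dots> = \<zero>\<^bsub>slot_space X N (p, q) s\<^esub>"
        unfolding * r by (rule dbar_comp_zero)
      finally have "?d (p, q) s = \<zero>\<^bsub>slot_space X N (p, q) s\<^esub>" .
      with b(4) show False by contradiction
    qed
    then have "?b \<in> ?S" using b r by (auto simp del: slot_space.simps intro!: bexI[of _ "Zquot r"])
    then have "b \<in> (\<lambda>(p, q). (p - (a + int r) - 1, q + (a + int r))) ` ?S"
      by (rule rev_image_eqI) (simp add: b)
    then show "b \<in> (\<Union>r<N. (\<lambda>(p, q). (p - (a + int r) - 1, q + (a + int r))) ` ?S)"
      using r by blast
  qed
  moreover have "finite ?S" using x unfolding total_carrier_iff by blast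
  then have "finite (\<Union>r<N. (\<lambda>(p, q). (p - (a + int r) - 1, q + (a + int r))) ` ?S)"
    by (intro finite_UN_I finite_imageI finite_lessThan)
  ultimately have "finite ?T" by (rule finite_subset)
  moreover have "?d (p, q) s \<in> carrier (slot_space X N (p, q) s)"
    if pq: "p + q = l - 1" and s: "s \<in> slots N" for p q s
  proof (cases "\<exists>r. s = Bquot r")
    case True
    then obtain r where Bquot: "s = Bquot r" ..
    note s' = s[unfolded Bquot]
    interpret d: linear_map K "slot_space X N (p + (a + int r) + 1, q - (a + int r)) (Zquot r)"
      "slot_space X N (p, q) (Bquot r)" "dbar_comp a X r (p + (a + int r) + 1, q - (a + int r))"
      by (rule dbar_comp_linear_into)
    show ?thesis
      unfolding Bquot total_diff_Bquot[OF pq s']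
      by (intro d.f_im total_carrierE[OF x]) (use pq s Bquot in auto)
  next
    case False
    show ?thesis
      unfolding total_diff_not_Bquot[OF pq s False] by (rule slot_zero(1))
  qed
  moreover have "?d \<in> extensional {(p, q). p + q = l - 1}"
    "p + q = l - 1 \<Longrightarrow> ?d (p, q) \<in> extensional (slots N)" for p q
    by (auto simp: total_diff_def)
  ultimately show ?thesis unfolding total_carrier_iff by blast
qed

text \<open>Checked coordinate by coordinate: \<open>Bquot r\<close> inherits linearity from
  \<open>dbar_comp\<close>, and in every other slot both sides are zero.\<close>

lemma total_diff_linear:
  "linear_map K (total_space X N l) (total_space X N (l - 1)) (total_diff a X N l)"
proof (intro linear_map.intro mod_hom.intro mod_hom_axioms.intro total_vectorspace
    vectorspace.axioms(1)[OF total_vectorspace])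
  let ?C = "total_space X N l" and ?C' = "total_space X N (l - 1)" and ?d = "total_diff a X N l"
  interpret C: vectorspace K ?C by (rule total_vectorspace)
  interpret C': vectorspace K ?C' by (rule total_vectorspace)
  have add: "?d (x \<oplus>\<^bsub>?C\<^esub> y) = ?d x \<oplus>\<^bsub>?C'\<^esub> ?d y" if x: "x \<in> carrier ?C" and y: "y \<in> carrier ?C" for x y
  proof (rule total_eqI)
    fix p q s assume pq: "p + q = l - 1" and s: "s \<in> slots N"
    show "?d (x \<oplus>\<^bsub>?C\<^esub> y) (p, q) s = (?d x \<oplus>\<^bsub>?C'\<^esub> ?d y) (p, q) s"
    proof (cases "\<exists>r. s = Bquot r")
      case True
      then obtain r where Bquot: "s = Bquot r" ..
      note s' = s[unfolded Bquot]
      interpret d: linear_map K "slot_space X N (p + (a + int r) + 1, q - (a + int r)) (Zquot r)"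
        "slot_space X N (p, q) (Bquot r)" "dbar_comp a X r (p + (a + int r) + 1, q - (a + int r))"
        by (rule dbar_comp_linear_into)
      \<comment> \<open>The terms \<open>a + r\<close> cancel, so the source lies in total degree
        one above that of the target whatever \<open>r\<close> is. The slots \<open>Bquot r\<close>
        and \<open>Zquot r\<close> occur for the same \<open>r\<close>.\<close>
      have b: "(p + (a + int r) + 1) + (q - (a + int r)) = l" "Zquot r \<in> slots N"
        using pq s Bquot by auto
      show ?thesis
        unfolding Bquot total_ops(1)[OF pq s'] total_diff_Bquot[OF pq s'] total_ops(1)[OF b]
        by (rule d.f_add) (use total_carrierE[OF _ b] x y in blast)+
    next
      case False
      then show ?thesis
        by (simp only: total_ops(1)[OF pq s] total_diff_not_Bquot[OF pq s False] slot_zero(2))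
    qed
  qed (use x y in \<open>auto intro: total_diff_closed\<close>)
  have smult: "?d (c \<odot>\<^bsub>?C\<^esub> x) = c \<odot>\<^bsub>?C'\<^esub> ?d x" if c: "c \<in> carrier K" and x: "x \<in> carrier ?C" for c x
  proof (rule total_eqI)
    fix p q s assume pq: "p + q = l - 1" and s: "s \<in> slots N"
    show "?d (c \<odot>\<^bsub>?C\<^esub> x) (p, q) s = (c \<odot>\<^bsub>?C'\<^esub> ?d x) (p, q) s"
    proof (cases "\<exists>r. s = Bquot r")
      case True
      then obtain r where Bquot: "s = Bquot r" ..
      note s' = s[unfolded Bquot]
      interpret d: linear_map K "slot_space X N (p + (a + int r) + 1, q - (a + int r)) (Zquot r)"
        "slot_space X N (p, q) (Bquot r)" "dbar_comp a X r (p + (a + int r) + 1, q - (a + int r))"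
        by (rule dbar_comp_linear_into)
      have b: "(p + (a + int r) + 1) + (q - (a + int r)) = l" "Zquot r \<in> slots N"
        using pq s Bquot by auto
      show ?thesis
        unfolding Bquot total_ops(2)[OF pq s'] total_diff_Bquot[OF pq s'] total_ops(2)[OF b]
        by (rule d.f_smult) (use total_carrierE[OF _ b] x c in blast)+
    next
      case False
      then show ?thesis
        by (simp only: total_ops(2)[OF pq s] total_diff_not_Bquot[OF pq s False] slot_zero(3)[OF c])
    qed
  qed (use x c in \<open>auto intro: total_diff_closed\<close>)
  show "?d \<in> module_hom K ?C ?C'"
    using add smult total_diff_closed by (simp add: module_hom_def)
qed

lemma total_diff_total_diff:
  assumes x: "x \<in> carrier (total_space X N l)"
  shows "total_diff a X N (l - 1) (total_diff a X N l x) = \<zero>\<^bsub>total_space X N (l - 1 - 1)\<^esub>"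
proof (rule total_eqI)
  interpret C: vectorspace K "total_space X N (l - 1 - 1)" by (rule total_vectorspace)
  have "abelian_group (total_space X N (l - 1 - 1))" by unfold_locales
  then show "\<zero>\<^bsub>total_space X N (l - 1 - 1)\<^esub> \<in> carrier (total_space X N (l - 1 - 1))"
    by (rule abelian_groupE(2))
  show "total_diff a X N (l - 1) (total_diff a X N l x) \<in> carrier (total_space X N (l - 1 - 1))"
    by (intro total_diff_closed x)
  fix p q s assume pq: "p + q = l - 1 - 1" and s: "s \<in> slots N"
  show "total_diff a X N (l - 1) (total_diff a X N l x) (p, q) s =
      \<zero>\<^bsub>total_space X N (l - 1 - 1)\<^esub> (p, q) s"
  proof (cases "\<exists>r. s = Bquot r")
    case True
    then obtain r where Bquot: "s = Bquot r" ..
    note s' = s[unfolded Bquot]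
    \<comment> \<open>The outer differential reads the slot \<open>Zquot r\<close> of the inner
      image, and that slot is zero because only the slots \<open>Bquot\<close> are ever
      filled.\<close>
    have b: "(p + (a + int r) + 1) + (q - (a + int r)) = l - 1" "Zquot r \<in> slots N"
      "\<nexists>r'. Zquot r = Bquot r'"
      using pq s Bquot by auto
    show ?thesis
      unfolding Bquot total_ops(3)[OF pq s'] total_diff_Bquot[OF pq s']
        total_diff_not_Bquot[OF b] by (rule dbar_comp_zero)
  next
    case False
    then show ?thesis
      by (simp only: total_ops(3)[OF pq s] total_diff_not_Bquot[OF pq s False])
  qed
qed

end

theorem proposition2p12:
  fixes K :: "('f, 'k) ring_scheme"
    and a :: int
    and X :: "('f, 'd, 'e) couple"
    and N :: nat
  assumes "field K"
    and "exact_couple K a X"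
    and "finite_total_dim K (spE X) (grE X)"
    and "\<And>r. r \<ge> N \<Longrightarrow> B_space X r = B_space X (r + 1)"
    and "\<And>r. r \<ge> N \<Longrightarrow> Z_space X r = Z_space X (r + 1)"
  shows "chain_complex K (total_space X N) (total_diff a X N)"
proof -
  interpret couple_over_field K a X by (rule couple_over_field.intro[OF assms(1,2)])
  show ?thesis
    unfolding chain_complex_def by (simp add: total_diff_linear total_diff_total_diff)
qed

end
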